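(* Let $\mathcal{E}$ be a finite-dimensional real inner product space, $K\subseteq\mathcal{E}$ a closed convex cone, and $a_1,\dots,a_k\in K$. Suppose that $b\in\mathbb{R}^k$ has all entries strictly positive and $c\in\mathrm{relint}(K)$, and let $y\in\mathbb{R}^k_+$ be an optimal point for the covering conic program $$\mathrm{cover}(b,c)=\inf\Big\{\langle b,z\rangle: z\in\mathbb{R}^k_+,\ \sum_{i=1}^k z_ia_i\succeq_K c\Big\}.$$ Then, for any $\epsilon\in(0,1)$, there exists $y'\in\mathbb{R}^k_+$ such that: (1) $y'$ is feasible for this covering program, i.e. $\sum_{i=1}^k y'_ia_i\succeq_K c$; (2) $y'$ has at most $\mathrm{sp}_K(\epsilon)$ non-zero entries; and (3) $\frac{1-\epsilon}{1+\epsilon}\langle b,y'\rangle\le\mathrm{cover}(b,c)\le\langle b,y'\rangle$.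
   Context: $x\preceq_K y$ (equivalently $y\succeq_K x$) means $y-x\in K$. Sparsification function. A sparsification function for a closed convex cone $K$ is a monotonically non-increasing upper semi-continuous function $\alpha:(0,1)\to\mathbb{R}$ such that for any $x_1,\dots,x_m\in K$ with $\sum_{i=1}^m x_i=e\in\mathrm{relint}(K)$ and any $0<\epsilon<1$, there exist $S\subseteq[m]$ with $|S|\le\alpha(\epsilon)$ and positive scalars $(\lambda_i)_{i\in S}$ such that $(1-\epsilon)e\preceq_K\sum_{i\in S}\lambda_i x_i\preceq_K(1+\epsilon)e$. Let $\mathcal{F}_K$ be the collection of all sparsification functions for $K$; the sparsification function of $K$ is $\mathrm{sp}_K(\epsilon)=\inf_{\alpha\in\mathcal{F}_K}\alpha(\epsilon)$, $\epsilon\in(0,1)$. *)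

theory Defs
  imports "HOL-Analysis.Analysis"
begin

definition cone_le :: "'a::real_vector set \<Rightarrow> 'a \<Rightarrow> 'a \<Rightarrow> bool" where
  "cone_le K x y \<longleftrightarrow> y - x \<in> K"

definition upper_semicontinuous_on :: "'a::topological_space set \<Rightarrow> ('a \<Rightarrow> real) \<Rightarrow> bool" where
  "upper_semicontinuous_on A f \<longleftrightarrow>
     (\<forall>x\<in>A. \<forall>r > f x. \<forall>\<^sub>F t in at x within A. f t < r)"

text \<open>Only the values of \<open>\<alpha>\<close> on the open unit interval are constrained.  The
  \<open>x i\<close> form an indexed family, so repetitions among them are allowed.\<close>

definition sparsification_function ::
    "'a::euclidean_space set \<Rightarrow> (real \<Rightarrow> real) \<Rightarrow> bool" where
  "sparsification_function K \<alpha> \<longleftrightarrow>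
     antimono_on {0<..<1} \<alpha> \<and>
     upper_semicontinuous_on {0<..<1} \<alpha> \<and>
     (\<forall>(m::nat) (x :: nat \<Rightarrow> 'a) e. \<forall>\<epsilon>\<in>{0<..<1}.
        (\<forall>i\<in>{1..m}. x i \<in> K) \<and> (\<Sum>i=1..m. x i) = e \<and> e \<in> rel_interior K \<longrightarrow>
        (\<exists>S w. S \<subseteq> {1..m} \<and> real (card S) \<le> \<alpha> \<epsilon> \<and> (\<forall>i\<in>S. 0 < w i) \<and>
               cone_le K ((1 - \<epsilon>) *\<^sub>R e) (\<Sum>i\<in>S. w i *\<^sub>R x i) \<and>
               cone_le K (\<Sum>i\<in>S. w i *\<^sub>R x i) ((1 + \<epsilon>) *\<^sub>R e)))"

text \<open>Infima are taken in the extended reals, so that they are meaningful without any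
  nonemptiness or boundedness side condition.\<close>

definition sp :: "'a::euclidean_space set \<Rightarrow> real \<Rightarrow> ereal" where
  "sp K \<epsilon> = (INF \<alpha>\<in>{\<alpha>. sparsification_function K \<alpha>}. ereal (\<alpha> \<epsilon>))"

definition cover_feasible ::
    "'a::real_vector set \<Rightarrow> ('k::finite \<Rightarrow> 'a) \<Rightarrow> 'a \<Rightarrow> (real^'k) set" where
  "cover_feasible K a c =
     {z. (\<forall>i. 0 \<le> z $ i) \<and> cone_le K c (\<Sum>i\<in>UNIV. (z $ i) *\<^sub>R a i)}"

definition cover ::
    "'a::real_vector set \<Rightarrow> ('k::finite \<Rightarrow> 'a) \<Rightarrow> real^'k \<Rightarrow> 'a \<Rightarrow> ereal" where
  "cover K a b c = (INF z\<in>cover_feasible K a c. ereal (b \<bullet> z))"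

definition cover_optimal ::
    "'a::real_vector set \<Rightarrow> ('k::finite \<Rightarrow> 'a) \<Rightarrow> real^'k \<Rightarrow> 'a \<Rightarrow> real^'k \<Rightarrow> bool" where
  "cover_optimal K a b c y \<longleftrightarrow>
     y \<in> cover_feasible K a c \<and> ereal (b \<bullet> y) = cover K a b c"

end

(* By optimality, no nonnegative combination w supported on the support of an optimal y with
   sum w_i a_i <= t (sum y_i a_i) can cost more than t times the optimum: otherwise
   y + s (t y - w), for small s > 0, would be feasible and cheaper than y.  Sparsifying the sum
   of the vectors y_i a_i, which lies in the relative interior because it dominates c, and dividing
   the weights by 1 - eps then gives the claim; no conic duality is needed. *)

theory Submission
  imports Defs
begin

text \<open>A point of a convex set is relatively interior iff every segment reaching it from a
  point of the set can be prolonged inside the set. If the segment from \<open>x\<close> to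
  \<open>c\<close> is prolonged by the factor \<open>t\<close>, adding \<open>t *\<^sub>R d\<close>
  to its new end prolongs the segment from \<open>x\<close> to \<open>c + d\<close> by the same
  factor.\<close>

lemma rel_interior_convex_cone_add:
  fixes K :: "'a::euclidean_space set"
  assumes K: "convex_cone K" and c: "c \<in> rel_interior K" and d: "d \<in> K"
  shows "c + d \<in> rel_interior K"
proof -
  have conv: "convex K" and ne: "K \<noteq> {}"
    using K by (auto simp: convex_cone_def)
  have "\<exists>t>1. (1 - t) *\<^sub>R x + t *\<^sub>R (c + d) \<in> K" if x: "x \<in> K" for x
  proof -
    obtain t where t: "t > 1" "(1 - t) *\<^sub>R x + t *\<^sub>R c \<in> K"
      using c x convex_rel_interior_iff[OF conv ne] by blast
    have "t *\<^sub>R d \<in> K"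
      using K d t(1) by (simp add: convex_cone_iff)
    with t(2) have "((1 - t) *\<^sub>R x + t *\<^sub>R c) + t *\<^sub>R d \<in> K"
      using K by (simp add: convex_cone_iff)
    with t(1) show ?thesis
      by (auto simp: algebra_simps)
  qed
  then show ?thesis
    using convex_rel_interior_iff[OF conv ne] by blast
qed

text \<open>Renumbering frees the family from the index set \<open>{1..m}\<close>. The vectors can
  then be indexed by the coordinates of \<open>y\<close>, so that the size of \<open>T\<close>
  bounds the size of a support.\<close>

lemma sparsification_function_finite_family:
  fixes K :: "'a::euclidean_space set" and x :: "'i \<Rightarrow> 'a"
  assumes \<alpha>: "sparsification_function K \<alpha>" and \<epsilon>: "0 < \<epsilon>" "\<epsilon> < 1"
    and I: "finite I" and x: "\<And>i. i \<in> I \<Longrightarrow> x i \<in> K"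
    and e: "(\<Sum>i\<in>I. x i) \<in> rel_interior K"
  obtains T w where "T \<subseteq> I" "real (card T) \<le> \<alpha> \<epsilon>" "\<And>i. i \<in> T \<Longrightarrow> 0 < w i"
    "cone_le K ((1 - \<epsilon>) *\<^sub>R (\<Sum>i\<in>I. x i)) (\<Sum>i\<in>T. w i *\<^sub>R x i)"
    "cone_le K (\<Sum>i\<in>T. w i *\<^sub>R x i) ((1 + \<epsilon>) *\<^sub>R (\<Sum>i\<in>I. x i))"
proof -
  obtain h where h: "bij_betw h {1..card I} I"
    using ex_bij_betw_nat_finite_1[OF I] by blast
  have sum: "(\<Sum>i=1..card I. x (h i)) = (\<Sum>i\<in>I. x i)"
    by (rule sum.reindex_bij_betw[OF h])
  have xh: "\<forall>i\<in>{1..card I}. x (h i) \<in> K"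
    using x bij_betwE[OF h] by blast
  obtain S v where S: "S \<subseteq> {1..card I}" "real (card S) \<le> \<alpha> \<epsilon>" "\<forall>i\<in>S. 0 < v i"
    "cone_le K ((1 - \<epsilon>) *\<^sub>R (\<Sum>i\<in>I. x i)) (\<Sum>i\<in>S. v i *\<^sub>R x (h i))"
    "cone_le K (\<Sum>i\<in>S. v i *\<^sub>R x (h i)) ((1 + \<epsilon>) *\<^sub>R (\<Sum>i\<in>I. x i))"
    using \<alpha>[unfolded sparsification_function_def, THEN conjunct2, THEN conjunct2,
        rule_format, of \<epsilon> "card I" "\<lambda>i. x (h i)"] \<epsilon> xh sum e
    by auto
  define w where "w = (\<lambda>j. v (inv_into {1..card I} h j))"
  have inj: "inj_on h S"
    using h S(1) by (auto simp: bij_betw_def intro: inj_on_subset)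
  have w: "w (h i) = v i" if "i \<in> S" for i
    unfolding w_def using bij_betw_inv_into_left[OF h] that S(1) by (metis subsetD)
  have "(\<Sum>j\<in>h ` S. w j *\<^sub>R x j) = (\<Sum>i\<in>S. v i *\<^sub>R x (h i))"
    by (simp add: sum.reindex[OF inj] w)
  moreover have "h ` S \<subseteq> I"
    using h S(1) by (auto simp: bij_betw_def)
  moreover have "0 < w j" if "j \<in> h ` S" for j
    using that S(3) w by auto
  ultimately show thesis
    using that[of "h ` S" w] S(2,4,5) by (simp add: card_image[OF inj])
qed

lemma cover_optimal_cost_le:
  fixes K :: "'a::real_vector set" and a :: "'k::finite \<Rightarrow> 'a" and b y w :: "real^'k"
  assumes K: "convex_cone K" and y: "cover_optimal K a b c y"
    and w: "\<And>i. y $ i = 0 \<Longrightarrow> w $ i = 0" and t: "0 \<le> t"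
    and le: "cone_le K (\<Sum>i\<in>UNIV. (w $ i) *\<^sub>R a i) (t *\<^sub>R (\<Sum>i\<in>UNIV. (y $ i) *\<^sub>R a i))"
  shows "b \<bullet> w \<le> t * (b \<bullet> y)"
proof (rule ccontr)
  assume "\<not> ?thesis"
  then have less: "t * (b \<bullet> y) - b \<bullet> w < 0" by simp
  have y0: "0 \<le> y $ i" for i
    using y by (simp add: cover_optimal_def cover_feasible_def)
  \<comment> \<open>Where \<open>y\<close> vanishes so does \<open>w\<close>, and the coordinate
    does not move; elsewhere it starts positive and stays so for small \<open>s\<close> by
    continuity. The coordinates are finite in number, so one \<open>s\<close> serves them
    all.\<close>
  have "\<forall>\<^sub>F s in at_right 0. 0 \<le> y $ i + s * (t * y $ i - w $ i)" for i
  proof (cases "y $ i = 0")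
    case True
    then show ?thesis by (simp add: w)
  next
    case False
    have "((\<lambda>s. y $ i + s * (t * y $ i - w $ i)) \<longlongrightarrow> y $ i + 0 * (t * y $ i - w $ i)) (at_right 0)"
      by (intro tendsto_intros)
    moreover have "0 < y $ i + 0 * (t * y $ i - w $ i)"
      using False y0[of i] by simp
    ultimately have "\<forall>\<^sub>F s in at_right 0. 0 < y $ i + s * (t * y $ i - w $ i)"
      by (rule order_tendstoD)
    then show ?thesis by (rule eventually_mono) simp
  qed
  then have "\<forall>\<^sub>F s in at_right 0. \<forall>i. 0 \<le> y $ i + s * (t * y $ i - w $ i)"
    by (simp add: eventually_all_finite)
  then have "\<forall>\<^sub>F s in at_right (0::real). 0 < s \<and> (\<forall>i. 0 \<le> y $ i + s * (t * y $ i - w $ i))"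
    by (intro eventually_conj) (auto simp: eventually_at_right_less)
  then obtain s where s: "0 < s" "\<And>i. 0 \<le> y $ i + s * (t * y $ i - w $ i)"
    by (auto dest!: eventually_happens)
  define z where "z = y + s *\<^sub>R (t *\<^sub>R y - w)"
  let ?A = "\<lambda>u::real^'k. \<Sum>i\<in>UNIV. (u $ i) *\<^sub>R a i"
  \<comment> \<open>The move adds a positive multiple of \<open>t *\<^sub>R ?A y - ?A w\<close>,
    which lies in \<open>K\<close> by \<open>le\<close>, so the covering constraint
    survives.\<close>
  have "?A z - c = (?A y - c) + s *\<^sub>R (t *\<^sub>R ?A y - ?A w)"
    by (simp add: z_def algebra_simps sum.distrib sum_subtractf scaleR_sum_right)
  moreover have "?A y - c \<in> K"
    using y by (simp add: cover_optimal_def cover_feasible_def cone_le_def)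
  moreover have "s *\<^sub>R (t *\<^sub>R ?A y - ?A w) \<in> K"
    using K le s(1) by (simp add: convex_cone_iff cone_le_def)
  ultimately have "?A z - c \<in> K"
    by (simp only: convex_cone_add[OF K])
  then have "z \<in> cover_feasible K a c"
    using s(2) by (simp add: cover_feasible_def cone_le_def z_def)
  then have "cover K a b c \<le> ereal (b \<bullet> z)"
    unfolding cover_def by (rule INF_lower)
  then have "b \<bullet> y \<le> b \<bullet> z"
    using y by (metis cover_optimal_def ereal_less_eq(3))
  moreover have "b \<bullet> z = b \<bullet> y + s * (t * (b \<bullet> y) - b \<bullet> w)"
    by (simp add: z_def inner_add_right inner_diff_right)
  ultimately show False
    using mult_pos_neg[OF s(1) less] by simp
qed

text \<open>The two sides of the sparsification have separate uses: the lower one yields feasibility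
  after rescaling, the upper one bounds the cost through optimality of \<open>y\<close>.\<close>

lemma cover_feasible_sparse:
  fixes K :: "'a::euclidean_space set" and a :: "'k::finite \<Rightarrow> 'a" and b y :: "real^'k"
  assumes K: "convex_cone K" and a: "\<And>i. a i \<in> K" and c: "c \<in> rel_interior K"
    and y: "cover_optimal K a b c y" and \<epsilon>: "0 < \<epsilon>" "\<epsilon> < 1"
    and \<alpha>: "sparsification_function K \<alpha>"
  obtains z where "z \<in> cover_feasible K a c" "real (card {i. z $ i \<noteq> 0}) \<le> \<alpha> \<epsilon>"
    "(1 - \<epsilon>) / (1 + \<epsilon>) * (b \<bullet> z) \<le> b \<bullet> y"
proof -
  let ?A = "\<lambda>u::real^'k. \<Sum>i\<in>UNIV. (u $ i) *\<^sub>R a i"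
  have y0: "0 \<le> y $ i" for i
    using y by (simp add: cover_optimal_def cover_feasible_def)
  have yc: "?A y - c \<in> K"
    using y by (simp add: cover_optimal_def cover_feasible_def cone_le_def)
  have e: "?A y \<in> rel_interior K"
    using rel_interior_convex_cone_add[OF K c yc] by simp
  have ya: "(y $ i) *\<^sub>R a i \<in> K" for i
    using K a y0 by (simp add: convex_cone_iff)
  obtain T l where T: "real (card T) \<le> \<alpha> \<epsilon>" and l: "\<And>i. i \<in> T \<Longrightarrow> 0 < l i"
    and lo: "cone_le K ((1 - \<epsilon>) *\<^sub>R ?A y) (\<Sum>i\<in>T. l i *\<^sub>R (y $ i) *\<^sub>R a i)"
    and up: "cone_le K (\<Sum>i\<in>T. l i *\<^sub>R (y $ i) *\<^sub>R a i) ((1 + \<epsilon>) *\<^sub>R ?A y)"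
    by (rule sparsification_function_finite_family[OF \<alpha> \<epsilon> finite[of UNIV] ya e]) blast
  \<comment> \<open>Since the vectors \<open>(y $ i) *\<^sub>R a i\<close> were sparsified instead
    of the \<open>a i\<close>, the coefficients carry the factor \<open>y $ i\<close> and vanish
    wherever \<open>y\<close> does, as the cost bound demands.\<close>
  define w :: "real^'k" where "w = (\<chi> i. if i \<in> T then l i * y $ i else 0)"
  have Aw: "?A w = (\<Sum>i\<in>T. l i *\<^sub>R (y $ i) *\<^sub>R a i)"
    by (rule sum.mono_neutral_cong_right) (auto simp: w_def)
  have bw: "b \<bullet> w \<le> (1 + \<epsilon>) * (b \<bullet> y)"
  proof (rule cover_optimal_cost_le[OF K y])
    show "cone_le K (?A w) ((1 + \<epsilon>) *\<^sub>R ?A y)"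
      using up by (simp only: Aw)
  qed (use \<epsilon>(1) in \<open>auto simp: w_def\<close>)
  \<comment> \<open>This scaling turns \<open>(1 - \<epsilon>) *\<^sub>R ?A y\<close> into
    \<open>?A y\<close>, which dominates \<open>c\<close>.\<close>
  define z where "z = (1 / (1 - \<epsilon>)) *\<^sub>R w"
  have "?A z - c = (1 / (1 - \<epsilon>)) *\<^sub>R (?A w - (1 - \<epsilon>) *\<^sub>R ?A y) + (?A y - c)"
  proof -
    have "?A z = (1 / (1 - \<epsilon>)) *\<^sub>R ?A w"
      by (simp add: z_def scaleR_sum_right)
    moreover have "(1 / (1 - \<epsilon>)) *\<^sub>R (1 - \<epsilon>) *\<^sub>R ?A y = ?A y"
      using \<epsilon>(2) by simp
    ultimately show ?thesis
      by (simp only: scaleR_diff_right) simp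
  qed
  moreover have "(1 / (1 - \<epsilon>)) *\<^sub>R (?A w - (1 - \<epsilon>) *\<^sub>R ?A y) \<in> K"
    using K lo \<epsilon>(2) by (simp add: convex_cone_iff cone_le_def Aw)
  ultimately have "?A z - c \<in> K"
    using yc by (simp only: convex_cone_add[OF K])
  moreover have "0 \<le> z $ i" for i
    using \<epsilon>(2) y0[of i] l[of i] by (auto simp: z_def w_def less_imp_le)
  ultimately have feas: "z \<in> cover_feasible K a c"
    by (simp add: cover_feasible_def cone_le_def)
  \<comment> \<open>Only an inequality: \<open>T\<close> may contain indices at which
    \<open>y\<close>, hence \<open>z\<close>, is zero.\<close>
  have "card {i. z $ i \<noteq> 0} \<le> card T"
    by (rule card_mono) (auto simp: z_def w_def split: if_splits)
  moreover have "(1 - \<epsilon>) / (1 + \<epsilon>) * (b \<bullet> z) \<le> b \<bullet> y"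
  proof -
    have "(1 - \<epsilon>) / (1 + \<epsilon>) * (b \<bullet> z) = (b \<bullet> w) / (1 + \<epsilon>)"
      using \<epsilon>(2) by (simp add: z_def)
    also have "\<dots> \<le> b \<bullet> y"
      using bw \<epsilon>(1) by (simp add: divide_le_eq mult.commute)
    finally show ?thesis .
  qed
  ultimately show thesis
    using that[OF feas] T by simp
qed

theorem proposition8p2:
  fixes K :: "'a::euclidean_space set"
    and a :: "'k::finite \<Rightarrow> 'a"
    and b y :: "real^'k"
    and c :: 'a
    and \<epsilon> :: real
  assumes "closed K" and "convex_cone K"
    and "\<forall>i. a i \<in> K"
    and "\<forall>i. 0 < b $ i"
    and "c \<in> rel_interior K"
    and "cover_optimal K a b c y"
    and "0 < \<epsilon>" and "\<epsilon> < 1"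
  shows "\<exists>y' :: real^'k.
           y' \<in> cover_feasible K a c \<and>
           ereal (real (card {i. y' $ i \<noteq> 0})) \<le> sp K \<epsilon> \<and>
           ereal ((1 - \<epsilon>) / (1 + \<epsilon>) * (b \<bullet> y')) \<le> cover K a b c \<and>
           cover K a b c \<le> ereal (b \<bullet> y')"
proof -
  let ?P = "\<lambda>z. z \<in> cover_feasible K a c \<and> (1 - \<epsilon>) / (1 + \<epsilon>) * (b \<bullet> z) \<le> b \<bullet> y"
  let ?n = "\<lambda>z::real^'k. card {i. z $ i \<noteq> 0}"
  have yf: "y \<in> cover_feasible K a c" and cov: "cover K a b c = ereal (b \<bullet> y)"
    using assms(6) by (auto simp: cover_optimal_def)
  \<comment> \<open>As \<open>(1 - \<epsilon>) / (1 + \<epsilon>) \<le> 1\<close>, a nonnegative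
    cost makes \<open>y\<close> itself satisfy \<open>?P\<close>. Candidates thus exist even if
    \<open>K\<close> has no sparsification function, in which case \<open>sp K \<epsilon>\<close> is
    infinite.\<close>
  have "0 \<le> b \<bullet> y"
    using yf assms(4) by (auto simp: inner_vec_def cover_feasible_def less_imp_le intro!: sum_nonneg)
  then have "?P y"
    using yf assms(7,8) by (auto simp: field_simps)
  \<comment> \<open>A point of minimal support works for all sparsification functions at once, although the
    infimum defining \<open>sp\<close> need not be attained.\<close>
  then obtain z where z: "?P z" and min: "\<And>u. ?P u \<Longrightarrow> ?n z \<le> ?n u"
    using ex_has_least_nat[of ?P y ?n] by blast
  have "ereal (real (?n z)) \<le> sp K \<epsilon>"
    unfolding sp_def
  proof (rule INF_greatest)
    fix \<alpha> assume "\<alpha> \<in> {\<alpha>. sparsification_function K \<alpha>}"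
    then have \<alpha>: "sparsification_function K \<alpha>" by simp
    obtain u where "?P u" "real (?n u) \<le> \<alpha> \<epsilon>"
      by (rule cover_feasible_sparse[OF assms(2) assms(3)[rule_format] assms(5-8) \<alpha>]) blast
    then show "ereal (real (?n z)) \<le> ereal (\<alpha> \<epsilon>)"
      using min[of u] by simp
  qed
  moreover have "cover K a b c \<le> ereal (b \<bullet> z)"
    unfolding cover_def using z by (intro INF_lower) blast
  ultimately show ?thesis
    using z cov by auto
qed

end
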